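(* Let $\varepsilon>0$, let $(X,d)$ be a Polish $\varepsilon$-geodesic metric space and let $P$ be the transition kernel of a Markov chain on $X$. Assume that: (1) there exist $\rho>0$ and a point $x_0\in X$ such that for all $x\in X$ with $\varepsilon<d(x,x_0)\le 2\varepsilon$, $$W_1(\delta_{x_0},P_x)\le d(x_0,x)-\rho;$$ (2) there exists a non-increasing function $K:\mathbb{R}_+\to\mathbb{R}_+$ such that $K_\varepsilon(x)\ge K(d(x,x_0))$ for all $x\in X$; (3) there exists $s>0$ such that for every $x\in X$, every $1$-Lipschitz function $f:X\to\mathbb{R}$ and every $\lambda\in\mathbb{R}$, $$\mathbb{E}_{P_x}\left[e^{\lambda f}\right]\le e^{\lambda\,\mathbb{E}_{P_x}[f]+\frac{\lambda^2s^2}{2}}.$$ Then for every $l>2\varepsilon+\frac{\ln(2)s^2}{\rho}$ and every equilibrium measure $\pi$ of the Markov chain, $$\mathbb{P}_{x\sim\pi}\big(d(x,x_0)\ge l\big)\le C_0\,e^{-\frac{1}{2s^2}\Phi(l)},$$ where $$\Phi(l):=\rho l+\int_{2\varepsilon}^l\left(\int_{2\varepsilon}^uK(v)\,dv\right)du$$ and $$C_0=\frac{\exp\left(\frac{3\varepsilon}{2s^2}\max\left(3\varepsilon,\rho+\frac{\ln(2)s^2}{\rho}\right)-\frac{\rho^2}{4s^2}+\frac{1}{2s^2}\left(\rho\left(2\varepsilon+\frac{\ln(2)s^2}{\rho}\right)+\int_{2\varepsilon}^{2\varepsilon+\frac{\ln(2)s^2}{\rho}}\int_{2\varepsilon}^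uK(v)\,dv\,du\right)\right)}{1-e^{-\frac{\rho^2}{4s^2}}}.$$
   Context: A metric space $(X,d)$ is $\varepsilon$-geodesic ($\varepsilon>0$) if for each $(x,y)\in X^2$ there exist $n\in\mathbb{N}$ and a sequence $x=x_0,x_1,\ldots,x_n=y$ in $X$ such that $d(x_i,x_{i+1})\le\varepsilon$ for each $0\le i\le n-1$ and $d(x,y)=\sum_{i=0}^{n-1}d(x_i,x_{i+1})$. $P_x$ denotes the law of the chain after one step from $x$. $W_1(\mu,\nu)$ is the $L^1$ Wasserstein distance: the infimum over couplings $(Y,Z)$ of $\mu$ and $\nu$ of $\mathbb{E}[d(Y,Z)]$. The coarse Ricci curvature between $x\ne y$ is $\kappa(x,y):=1-\frac{W_1(P_x,P_y)}{d(x,y)}$, and the local coarse Ricci curvature at $x$ is $K_\varepsilon(x):=\inf\{\kappa(x,y): y\in X,\ 0<d(x,y)\le\varepsilon\}$ (infimum of the empty set being $+\infty$). An equilibrium measure is an invariant probability measure of the Markov chain. The exponential moment hypothesis is understood to include that $1$-Lipschitz functions, and their exponentials $e^{\lambda f}$, are $P_x$-integrable. *)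

theory Defs
  imports "HOL-Probability.Probability"
begin

definition eps_geodesic :: "real \<Rightarrow> 'a::metric_space itself \<Rightarrow> bool" where
  "eps_geodesic \<epsilon> TYPE('a) \<longleftrightarrow>
     (\<forall>x y :: 'a. \<exists>(n::nat) (p :: nat \<Rightarrow> 'a). p 0 = x \<and> p n = y \<and>
        (\<forall>i<n. dist (p i) (p (Suc i)) \<le> \<epsilon>) \<and>
        dist x y = (\<Sum>i<n. dist (p i) (p (Suc i))))"

definition couplings :: "'a::polish_space measure \<Rightarrow> 'a measure \<Rightarrow> ('a \<times> 'a) measure set" where
  "couplings \<mu> \<nu> = {\<gamma> \<in> space (prob_algebra (borel \<Otimes>\<^sub>M borel)).
     distr \<gamma> borel fst = \<mu> \<and> distr \<gamma> borel snd = \<nu>}"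

definition W1 :: "'a::polish_space measure \<Rightarrow> 'a measure \<Rightarrow> ennreal" where
  "W1 \<mu> \<nu> = (INF \<gamma> \<in> couplings \<mu> \<nu>. \<integral>\<^sup>+ z. ennreal (dist (fst z) (snd z)) \<partial>\<gamma>)"

(* Extended reals: W1 may a priori be infinite, and the infimum over an empty set of
   neighbours has to be +infinity. *)
definition coarse_ricci :: "('a::polish_space \<Rightarrow> 'a measure) \<Rightarrow> 'a \<Rightarrow> 'a \<Rightarrow> ereal" where
  "coarse_ricci P x y = 1 - enn2ereal (W1 (P x) (P y)) / ereal (dist x y)"

definition local_coarse_ricci ::
    "('a::polish_space \<Rightarrow> 'a measure) \<Rightarrow> real \<Rightarrow> 'a \<Rightarrow> ereal" where
  "local_coarse_ricci P \<epsilon> x = (INF y \<in> {y. 0 < dist x y \<and> dist x y \<le> \<epsilon>}. coarse_ricci P x y)"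

definition markov_kernel :: "('a::polish_space \<Rightarrow> 'a measure) \<Rightarrow> bool" where
  "markov_kernel P \<longleftrightarrow> P \<in> borel \<rightarrow>\<^sub>M prob_algebra borel"

definition equilibrium_measure ::
    "('a::polish_space \<Rightarrow> 'a measure) \<Rightarrow> 'a measure \<Rightarrow> bool" where
  "equilibrium_measure P \<pi> \<longleftrightarrow> \<pi> \<in> space (prob_algebra borel) \<and> \<pi> \<bind> P = \<pi>"

(* The integrability conjuncts matter: without them the Bochner integrals of
   non-integrable functions would be 0 and the inequality would lose its meaning. *)
definition gaussian_exp_moments :: "real \<Rightarrow> 'a::polish_space measure \<Rightarrow> bool" where
  "gaussian_exp_moments s \<mu> \<longleftrightarrow>
     (\<forall>f :: 'a \<Rightarrow> real. 1-lipschitz_on UNIV f \<longrightarrow>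
        integrable \<mu> f \<and>
        (\<forall>t::real. integrable \<mu> (\<lambda>y. exp (t * f y)) \<and>
           (\<integral>y. exp (t * f y) \<partial>\<mu>) \<le> exp (t * (\<integral>y. f y \<partial>\<mu>) + t\<^sup>2 * s\<^sup>2 / 2)))"

definition Phi :: "real \<Rightarrow> real \<Rightarrow> (real \<Rightarrow> real) \<Rightarrow> real \<Rightarrow> real" where
  "Phi \<epsilon> \<rho> K l = \<rho> * l + integral {2*\<epsilon>..l} (\<lambda>u. integral {2*\<epsilon>..u} K)"

definition C0 :: "real \<Rightarrow> real \<Rightarrow> real \<Rightarrow> (real \<Rightarrow> real) \<Rightarrow> real" where
  "C0 \<epsilon> \<rho> s K =
     exp (3 * \<epsilon> / (2 * s\<^sup>2) * max (3 * \<epsilon>) (\<rho> + ln 2 * s\<^sup>2 / \<rho>)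
          - \<rho>\<^sup>2 / (4 * s\<^sup>2)
          + 1 / (2 * s\<^sup>2) *
              (\<rho> * (2 * \<epsilon> + ln 2 * s\<^sup>2 / \<rho>)
               + integral {2*\<epsilon>..2*\<epsilon> + ln 2 * s\<^sup>2 / \<rho>} (\<lambda>u. integral {2*\<epsilon>..u} K)))
     / (1 - exp (- (\<rho>\<^sup>2 / (4 * s\<^sup>2))))"

end

theory Submission
  imports Defs
begin

text \<open>
  Write \<open>r\<close> for the distance to \<open>x0\<close>, \<open>J\<close> for the integral of \<open>K\<close> from \<open>2\<epsilon>\<close> and \<open>\<phi> = \<rho> + J\<close>, so
  that \<open>\<Phi>' = \<phi>\<close>. Summing the curvature bound along an \<open>\<epsilon>\<close>-geodesic issued from \<open>x0\<close> shows that
  one step of the chain lowers the expected distance by at least \<open>\<phi>(r)\<close>. Since \<open>J\<close> is concave on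
  \<open>{2\<epsilon>..}\<close>, \<open>\<Phi>\<close> is dominated by the parabola tangent to it at \<open>r\<close> with curvature
  \<open>k = J(r) / (r - 2\<epsilon>) \<le> 1\<close>. Sub-Gaussianity bounds the exponential moment of that parabola at the cost
  of a factor \<open>1 / sqrt (1 - k/2) \<le> 2 powr (k/2)\<close>, and for \<open>r \<ge> 2\<epsilon> + ln 2 s\<^sup>2 / \<rho>\<close> this factor is paid for by
  \<open>\<phi>(r)\<^sup>2 \<ge> \<rho>\<^sup>2 + 2 k ln 2 s\<^sup>2\<close>. Hence \<open>V = exp (\<Phi>(r) / 2s\<^sup>2)\<close> is a Lyapunov function contracted
  by \<open>exp (- \<rho>\<^sup>2 / 4s\<^sup>2)\<close> outside a ball, and its integral against an invariant measure gives the tail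
  bound by Markov's inequality.
\<close>

section \<open>Exponential moments of quadratic functions\<close>

text \<open>Completing the square: with \<open>c = 1 - \<gamma>\<close> the integrand is a constant
  times the normal density of mean \<open>\<beta> / c\<close> and variance
  \<open>1 / c\<close>.\<close>

lemma nn_integral_std_normal_exp_quadratic:
  fixes \<beta> \<gamma> :: real
  assumes "\<gamma> < 1"
  shows "(\<integral>\<^sup>+n. ennreal (std_normal_density n * exp (\<beta> * n + \<gamma> * n\<^sup>2 / 2)) \<partial>lborel)
       = ennreal (exp (\<beta>\<^sup>2 / (2 * (1 - \<gamma>))) / sqrt (1 - \<gamma>))"
proof -
  define c where "c = 1 - \<gamma>"
  have c: "c > 0" using assms by (simp add: c_def)
  have "std_normal_density n * exp (\<beta> * n + \<gamma> * n\<^sup>2 / 2)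
      = exp (\<beta>\<^sup>2 / (2 * c)) / sqrt c * normal_density (\<beta> / c) (1 / sqrt c) n" for n
  proof -
    have "- (n - \<beta> / c)\<^sup>2 / (2 * (1 / sqrt c)\<^sup>2) + \<beta>\<^sup>2 / (2 * c) = \<beta> * n + (1 - c) * n\<^sup>2 / 2 - n\<^sup>2 / 2"
      using c by (simp add: power2_eq_square field_simps)
    moreover have "sqrt (2 * pi * (1 / sqrt c)\<^sup>2) = sqrt (2 * pi) / sqrt c"
      using c by (simp add: power_divide real_sqrt_divide real_sqrt_mult)
    ultimately show ?thesis
      using c by (simp add: normal_density_def mult_exp_exp c_def algebra_simps flip: exp_add)
  qed
  then have "(\<integral>\<^sup>+n. ennreal (std_normal_density n * exp (\<beta> * n + \<gamma> * n\<^sup>2 / 2)) \<partial>lborel)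
      = (\<integral>\<^sup>+n. ennreal (exp (\<beta>\<^sup>2 / (2 * c)) / sqrt c) * ennreal (normal_density (\<beta> / c) (1 / sqrt c) n) \<partial>lborel)"
    using c by (simp flip: ennreal_mult)
  also have "\<dots> = ennreal (exp (\<beta>\<^sup>2 / (2 * c)) / sqrt c) * 1"
    using c by (subst nn_integral_cmult)
      (simp_all add: nn_integral_eq_integral integrable_normal_density integral_normal_density)
  finally show ?thesis by (simp add: c_def)
qed

text \<open>The quadratic term is linearised by averaging \<open>exp (sqrt (2 * a) * n * Z)\<close> over an independent
  standard Gaussian \<open>n\<close>.\<close>
lemma gaussian_exp_moments_quadratic:
  fixes f :: "'a::polish_space \<Rightarrow> real"
  assumes \<mu>: "prob_space \<mu>" and sets [measurable_cong, simp]: "sets \<mu> = sets borel"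
    and g: "gaussian_exp_moments s \<mu>" and f: "1-lipschitz_on UNIV f"
    and a: "a \<ge> 0" "2 * a * s\<^sup>2 < 1"
  defines "m \<equiv> \<integral>y. f y \<partial>\<mu>"
  shows "(\<integral>\<^sup>+y. ennreal (exp (\<alpha> * (f y - m) + a * (f y - m)\<^sup>2)) \<partial>\<mu>)
       \<le> ennreal (exp (\<alpha>\<^sup>2 * s\<^sup>2 / (2 * (1 - 2 * a * s\<^sup>2))) / sqrt (1 - 2 * a * s\<^sup>2))"
proof -
  interpret prob_space \<mu> by fact
  interpret N: pair_sigma_finite lborel \<mu> ..
  have [measurable]: "f \<in> borel_measurable \<mu>"
    using g f unfolding gaussian_exp_moments_def by (blast intro: borel_measurable_integrable)
  define b where "b = sqrt (2 * a)"
  have b2: "b\<^sup>2 = 2 * a" using a by (simp add: b_def)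
  define \<gamma> where "\<gamma> = 2 * a * s\<^sup>2"
  have \<gamma>: "\<gamma> < 1" using a by (simp add: \<gamma>_def)
  \<comment> \<open>Centred form of the sub-Gaussian bound, applied below with
    \<open>t = \<alpha> + b * n\<close> for each frozen value of the Gaussian
    \<open>n\<close>.\<close>
  have mgf: "(\<integral>\<^sup>+y. ennreal (exp (t * (f y - m))) \<partial>\<mu>) \<le> ennreal (exp (t\<^sup>2 * s\<^sup>2 / 2))" for t
  proof -
    have i: "integrable \<mu> (\<lambda>y. exp (t * f y))"
      and le: "(\<integral>y. exp (t * f y) \<partial>\<mu>) \<le> exp (t * m + t\<^sup>2 * s\<^sup>2 / 2)"
      using g f unfolding gaussian_exp_moments_def m_def by blast+
    have eq: "exp (t * (f y - m)) = exp (- t * m) * exp (t * f y)" for y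
      by (simp add: algebra_simps flip: exp_add)
    have "(\<integral>\<^sup>+y. ennreal (exp (t * (f y - m))) \<partial>\<mu>) = ennreal (exp (- t * m) * (\<integral>y. exp (t * f y) \<partial>\<mu>))"
      unfolding eq by (subst nn_integral_eq_integral) (use i in auto)
    also have "exp (- t * m) * (\<integral>y. exp (t * f y) \<partial>\<mu>) \<le> exp (- t * m) * exp (t * m + t\<^sup>2 * s\<^sup>2 / 2)"
      using le by (intro mult_left_mono) auto
    also have "\<dots> = exp (t\<^sup>2 * s\<^sup>2 / 2)" by (simp flip: exp_add)
    finally show ?thesis by (simp add: ennreal_leI)
  qed
  have "(\<integral>\<^sup>+y. ennreal (exp (\<alpha> * (f y - m) + a * (f y - m)\<^sup>2)) \<partial>\<mu>)
      = (\<integral>\<^sup>+y. (\<integral>\<^sup>+n. ennreal (std_normal_density n * exp ((\<alpha> + b * n) * (f y - m))) \<partial>lborel) \<partial>\<mu>)"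
  proof (rule nn_integral_cong)
    fix y
    define z where "z = f y - m"
    have "(\<integral>\<^sup>+n. ennreal (std_normal_density n * exp ((\<alpha> + b * n) * z)) \<partial>lborel)
       = (\<integral>\<^sup>+n. ennreal (exp (\<alpha> * z)) * ennreal (std_normal_density n * exp ((b * z) * n + 0 * n\<^sup>2 / 2)) \<partial>lborel)"
      by (intro nn_integral_cong) (simp add: algebra_simps exp_add flip: ennreal_mult)
    also have "\<dots> = ennreal (exp (\<alpha> * z)) * ennreal (exp ((b * z)\<^sup>2 / 2))"
      by (subst nn_integral_cmult) (simp_all add: nn_integral_std_normal_exp_quadratic[of 0, simplified])
    also have "\<dots> = ennreal (exp (\<alpha> * z + a * z\<^sup>2))"
      by (simp add: power_mult_distrib b2 exp_add flip: ennreal_mult)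
    finally show "ennreal (exp (\<alpha> * (f y - m) + a * (f y - m)\<^sup>2))
      = (\<integral>\<^sup>+n. ennreal (std_normal_density n * exp ((\<alpha> + b * n) * (f y - m))) \<partial>lborel)"
      by (simp add: z_def)
  qed
  also have "\<dots> = (\<integral>\<^sup>+n. (\<integral>\<^sup>+y. ennreal (std_normal_density n * exp ((\<alpha> + b * n) * (f y - m))) \<partial>\<mu>) \<partial>lborel)"
    by (rule N.Fubini') measurable
  also have "\<dots> \<le> (\<integral>\<^sup>+n. ennreal (std_normal_density n) * ennreal (exp ((\<alpha> + b * n)\<^sup>2 * s\<^sup>2 / 2)) \<partial>lborel)"
    by (intro nn_integral_mono) (auto simp: ennreal_mult nn_integral_cmult intro!: mult_left_mono mgf)
  \<comment> \<open>Expanding the square leaves \<open>\<gamma> / 2\<close> as the coefficient of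
    \<open>n\<^sup>2\<close> in the exponent beside the density; \<open>\<gamma> < 1\<close> keeps
    the integral finite.\<close>
  also have "\<dots> = (\<integral>\<^sup>+n. ennreal (exp (\<alpha>\<^sup>2 * s\<^sup>2 / 2)) *
      ennreal (std_normal_density n * exp ((\<alpha> * b * s\<^sup>2) * n + \<gamma> * n\<^sup>2 / 2)) \<partial>lborel)"
  proof (rule nn_integral_cong)
    fix n
    have "(\<alpha> + b * n)\<^sup>2 * s\<^sup>2 / 2 = \<alpha>\<^sup>2 * s\<^sup>2 / 2 + ((\<alpha> * b * s\<^sup>2) * n + b\<^sup>2 * s\<^sup>2 * n\<^sup>2 / 2)"
      by (simp add: power2_eq_square field_simps)
    then have "exp ((\<alpha> + b * n)\<^sup>2 * s\<^sup>2 / 2) = exp (\<alpha>\<^sup>2 * s\<^sup>2 / 2) * exp ((\<alpha> * b * s\<^sup>2) * n + \<gamma> * n\<^sup>2 / 2)"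
      by (simp only: exp_add b2 \<gamma>_def)
    then show "ennreal (std_normal_density n) * ennreal (exp ((\<alpha> + b * n)\<^sup>2 * s\<^sup>2 / 2)) =
      ennreal (exp (\<alpha>\<^sup>2 * s\<^sup>2 / 2)) * ennreal (std_normal_density n * exp ((\<alpha> * b * s\<^sup>2) * n + \<gamma> * n\<^sup>2 / 2))"
      by (simp add: mult_ac flip: ennreal_mult)
  qed
  also have "\<dots> = ennreal (exp (\<alpha>\<^sup>2 * s\<^sup>2 / 2)) * ennreal (exp ((\<alpha> * b * s\<^sup>2)\<^sup>2 / (2 * (1 - \<gamma>))) / sqrt (1 - \<gamma>))"
    by (subst nn_integral_cmult) (simp_all add: nn_integral_std_normal_exp_quadratic[OF \<gamma>])
  also have "\<dots> = ennreal (exp (\<alpha>\<^sup>2 * s\<^sup>2 / 2 + (\<alpha> * b * s\<^sup>2)\<^sup>2 / (2 * (1 - \<gamma>))) / sqrt (1 - \<gamma>))"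
    using \<gamma> by (simp add: exp_add flip: ennreal_mult)
  also have "\<alpha>\<^sup>2 * s\<^sup>2 / 2 + (\<alpha> * b * s\<^sup>2)\<^sup>2 / (2 * (1 - \<gamma>)) = \<alpha>\<^sup>2 * s\<^sup>2 / (2 * (1 - \<gamma>))"
  proof -
    have "(\<alpha> * b * s\<^sup>2)\<^sup>2 = \<alpha>\<^sup>2 * s\<^sup>2 * \<gamma>"
      by (simp add: power_mult_distrib b2 \<gamma>_def)
    then have "\<alpha>\<^sup>2 * s\<^sup>2 / 2 + (\<alpha> * b * s\<^sup>2)\<^sup>2 / (2 * (1 - \<gamma>)) = \<alpha>\<^sup>2 * s\<^sup>2 / 2 + \<alpha>\<^sup>2 * s\<^sup>2 * \<gamma> / (2 * (1 - \<gamma>))"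
      by (simp only:)
    then show ?thesis using \<gamma> by (simp add: field_simps)
  qed
  finally show ?thesis by (simp add: \<gamma>_def)
qed

section \<open>Iterated integrals of a non-increasing rate\<close>

text \<open>Used with \<open>a = 2 * \<epsilon>\<close>. The bound by 1 makes \<open>J\<close>
  1-Lipschitz, so that the slope \<open>k = J r / (r - a)\<close> never exceeds 1.\<close>

locale rate_profile =
  fixes K :: "real \<Rightarrow> real" and a :: real
  assumes a_nonneg: "a \<ge> 0"
    and K_antimono: "antimono_on {0..} K"
    and K_nonneg: "r \<ge> 0 \<Longrightarrow> K r \<ge> 0"
    and K_le_1: "r \<ge> 0 \<Longrightarrow> K r \<le> 1"
begin

text \<open>Integrals over empty intervals are 0, so \<open>J\<close>, and with it \<open>G\<close>,
  vanishes on \<open>{..a}\<close>; both can then be compared with lines and parabolas on the whole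
  real line.\<close>

definition J :: "real \<Rightarrow> real" where "J u = integral {a..u} K"

definition G :: "real \<Rightarrow> real" where "G u = integral {a..u} J"

lemma K_mono: "0 \<le> x \<Longrightarrow> x \<le> y \<Longrightarrow> K y \<le> K x"
  using K_antimono by (auto simp: monotone_on_def)

lemma K_integrable: "0 \<le> b \<Longrightarrow> K integrable_on {b..c}"
  using integrable_on_mono_on[of b c "\<lambda>x. - K x"] integrable_neg[of "\<lambda>x. - K x" "{b..c}"]
  by (auto simp: mono_on_def K_mono)

lemma J_eq_0: "u \<le> a \<Longrightarrow> J u = 0"
  unfolding J_def by (cases "u = a") auto

lemma J_diff: "a \<le> u \<Longrightarrow> u \<le> v \<Longrightarrow> J v - J u = integral {u..v} K"
  using Henstock_Kurzweil_Integration.integral_combine[where a = a and c = u and b = v and f = K] K_integrable[of a v] a_nonneg by (simp add: J_def)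

lemma J_diff_bounds:
  assumes "a \<le> u" "u \<le> v"
  shows "J v - J u \<le> (v - u) * K u" and "(v - u) * K v \<le> J v - J u"
proof -
  have "integral {u..v} K \<le> integral {u..v} (\<lambda>_. K u)"
    by (intro integral_le K_integrable) (use assms a_nonneg in \<open>auto intro: K_mono\<close>)
  then show "J v - J u \<le> (v - u) * K u" using assms by (simp add: J_diff)
  have "integral {u..v} (\<lambda>_. K v) \<le> integral {u..v} K"
    by (intro integral_le K_integrable) (use assms a_nonneg in \<open>auto intro: K_mono\<close>)
  then show "(v - u) * K v \<le> J v - J u" using assms by (simp add: J_diff)
qed

lemma J_mono: "u \<le> v \<Longrightarrow> J u \<le> J v"
proof -
  have *: "J u \<le> J v" if "a \<le> u" "u \<le> v" for u v
    using J_diff_bounds(2)[OF that] that K_nonneg[of v] a_nonneg mult_nonneg_nonneg[of "v - u" "K v"]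
    by linarith
  show "u \<le> v \<Longrightarrow> J u \<le> J v"
    using *[of u v] *[of a v] J_eq_0[of u] J_eq_0[of v] J_eq_0[of a] by linarith
qed

lemma J_nonneg: "J u \<ge> 0"
  using J_mono[of "min u a" u] J_eq_0[of "min u a"] by simp

text \<open>\<open>u\<close> may lie below \<open>a\<close>, where \<open>J\<close> is flat and
  \<open>K u \<ge> K a\<close>. This covers a geodesic link that crosses the radius
  \<open>a\<close>.\<close>

lemma J_diff_le:
  assumes "0 \<le> u" "u \<le> v"
  shows "J v - J u \<le> (v - u) * K u"
proof -
  consider "a \<le> u" | "u \<le> a" "a \<le> v" | "v \<le> a" by linarith
  then show ?thesis
  proof cases
    case 2
    have "J v - J a \<le> (v - a) * K a" using 2 by (intro J_diff_bounds) auto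
    also have "\<dots> \<le> (v - u) * K u"
      using 2 assms by (intro mult_mono K_mono K_nonneg) auto
    finally show ?thesis using 2 by (simp add: J_eq_0)
  qed (use assms J_diff_bounds K_nonneg in \<open>auto simp: J_eq_0\<close>)
qed

lemma J_diff_le_length: "u \<le> v \<Longrightarrow> J v - J u \<le> v - u"
proof -
  assume uv: "u \<le> v"
  have *: "J v - J u \<le> v - u" if "a \<le> u" "u \<le> v" for u v
    using J_diff_bounds(1)[OF that] that K_le_1[of u] a_nonneg mult_left_mono[of "K u" 1 "v - u"]
    by auto
  show ?thesis
    using uv *[of u v] *[of a v] J_eq_0[of u] J_eq_0[of v] J_eq_0[of a] by linarith
qed

lemma J_integrable: "J integrable_on {b..c}"
  by (rule integrable_on_mono_on) (simp add: mono_on_def J_mono)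

lemma G_diff: assumes "u \<le> v" shows "G v - G u = integral {u..v} J"
proof -
  have *: "G v - G u = integral {u..v} J" if "a \<le> u" "u \<le> v" for u v
    using Henstock_Kurzweil_Integration.integral_combine[where a = a and c = u and b = v and f = J] J_integrable[of a v] that by (simp add: G_def)
  have z: "G w = 0" if "w \<le> a" for w
    using that unfolding G_def by (cases "w = a") auto
  have i: "integral {u..w} J = 0" if "w \<le> a" for w
    using has_integral_is_0[of "{u..w}" J] that by (simp add: J_eq_0 integral_unique)
  consider "a \<le> u" | "u \<le> a" "a \<le> v" | "v \<le> a" by linarith
  then show ?thesis
  proof cases
    case 2
    then have "integral {u..a} J + integral {a..v} J = integral {u..v} J"
      by (intro Henstock_Kurzweil_Integration.integral_combine J_integrable)
    then show ?thesis using 2 *[of a v] z[of a] z[of u] i[of a] by simp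
  qed (use assms * z i in auto)
qed

lemma G_mono: "u \<le> v \<Longrightarrow> G u \<le> G v"
  using G_diff[of u v] integral_nonneg[OF J_integrable[of u v]] J_nonneg by auto

lemma integral_line:
  fixes k c :: real
  assumes "u \<le> v"
  shows "((\<lambda>w. k * (w - c)) has_integral (k * (v - c)\<^sup>2 / 2 - k * (u - c)\<^sup>2 / 2)) {u..v}"
  by (rule fundamental_theorem_of_calculus[OF assms])
    (auto intro!: derivative_eq_intros simp: field_simps simp flip: has_real_derivative_iff_has_vector_derivative)

text \<open>By concavity of \<open>J\<close> on \<open>{a..}\<close>, the line through \<open>(a, 0)\<close> and \<open>(r, J r)\<close> lies below \<open>J\<close>
  to the left of \<open>r\<close> and above it to the right.\<close>
lemma J_secant:
  assumes r: "a < r"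
  defines "k \<equiv> J r / (r - a)"
  shows "v \<le> r \<Longrightarrow> k * (v - a) \<le> J v" and "r \<le> v \<Longrightarrow> J v \<le> k * (v - a)"
proof -
  have k0: "k \<ge> 0" using r J_nonneg by (simp add: k_def)
  have kr: "k * (r - a) = J r" using r by (simp add: k_def)
  {
    assume v: "v \<le> r"
    show "k * (v - a) \<le> J v"
    proof (cases "a \<le> v")
      case True
      \<comment> \<open>As \<open>K\<close> is non-increasing, \<open>K v\<close> lies between the
        mean slope of \<open>J\<close> on \<open>{v..r}\<close> and the larger one on
        \<open>{a..v}\<close>; cross-multiplying compares the two.\<close>
      have 1: "J r - J v \<le> (r - v) * K v" using True v by (intro J_diff_bounds)
      have 2: "(v - a) * K v \<le> J v" using J_diff_bounds(2)[of a v] True by (simp add: J_eq_0)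
      have "(v - a) * (J r - J v) \<le> (v - a) * ((r - v) * K v)"
        using 1 True by (intro mult_left_mono) auto
      also have "\<dots> = (r - v) * ((v - a) * K v)" by simp
      also have "\<dots> \<le> (r - v) * J v" using 2 v by (intro mult_left_mono) auto
      finally have "(v - a) * J r \<le> (r - a) * J v" by (simp add: algebra_simps)
      then show ?thesis using r by (simp add: k_def field_simps)
    next
      case False
      then show ?thesis using k0 by (simp add: J_eq_0 mult_nonneg_nonpos)
    qed
  }
  {
    assume v: "r \<le> v"
    have 1: "J v - J r \<le> (v - r) * K r" using r v by (intro J_diff_bounds) auto
    have "(r - a) * K r \<le> J r" using J_diff_bounds(2)[of a r] r by (simp add: J_eq_0)
    then have "K r \<le> k" using r by (simp add: k_def field_simps)
    then have "(v - r) * K r \<le> (v - r) * k" using v by (intro mult_left_mono) auto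
    with 1 kr show "J v \<le> k * (v - a)" by (simp add: algebra_simps)
  }
qed

text \<open>The parabola minus \<open>G\<close> vanishes at \<open>r\<close> and has derivative
  \<open>k * (u - a) - J u\<close>, which by \<open>J_secant\<close> is nonpositive before
  \<open>r\<close> and nonnegative after it. The proof integrates these two comparisons.\<close>

lemma G_quadratic_majorant:
  assumes r: "a < r"
  defines "k \<equiv> J r / (r - a)"
  shows "G u \<le> G r + J r * (u - r) + k * (u - r)\<^sup>2 / 2"
proof -
  have kr: "J r = k * (r - a)" using r by (simp add: k_def)
  have eq: "J r * (u - r) + k * (u - r)\<^sup>2 / 2 = k * (u - a)\<^sup>2 / 2 - k * (r - a)\<^sup>2 / 2"
    unfolding kr by (simp add: power2_eq_square field_simps)
  show ?thesis
  proof (cases "u \<le> r")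
    case True
    have "k * (r - a)\<^sup>2 / 2 - k * (u - a)\<^sup>2 / 2 \<le> integral {u..r} J"
      by (rule has_integral_le[OF integral_line[OF True] integrable_integral[OF J_integrable]])
        (use J_secant(1)[OF r] in \<open>auto simp: k_def\<close>)
    then show ?thesis using eq G_diff[OF True] by linarith
  next
    case False
    then have ru: "r \<le> u" by simp
    have "integral {r..u} J \<le> k * (u - a)\<^sup>2 / 2 - k * (r - a)\<^sup>2 / 2"
      by (rule has_integral_le[OF integrable_integral[OF J_integrable] integral_line[OF ru]])
        (use J_secant(2)[OF r] in \<open>auto simp: k_def\<close>)
    then show ?thesis using eq G_diff[OF ru] by linarith
  qed
qed

end

section \<open>Drift towards the base point\<close>

text \<open>The easy half of Kantorovich-Rubinstein duality: under any coupling the difference of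
  the means is the expectation of \<open>f (fst z) - f (snd z)\<close>, bounded by the transport
  cost.\<close>

lemma W1_lipschitz:
  fixes f :: "'a::polish_space \<Rightarrow> real"
  assumes f: "1-lipschitz_on UNIV f" and "integrable \<mu> f" "integrable \<nu> f"
  shows "ennreal \<bar>(\<integral>y. f y \<partial>\<mu>) - (\<integral>y. f y \<partial>\<nu>)\<bar> \<le> W1 \<mu> \<nu>"
  unfolding W1_def
proof (rule INF_greatest)
  fix \<gamma> assume "\<gamma> \<in> couplings \<mu> \<nu>"
  then have [measurable_cong]: "sets \<gamma> = sets (borel \<Otimes>\<^sub>M borel)"
    and \<mu>: "distr \<gamma> borel fst = \<mu>" and \<nu>: "distr \<gamma> borel snd = \<nu>"
    by (auto simp: couplings_def space_prob_algebra)
  have [measurable]: "f \<in> borel_measurable borel"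
    using f by (intro borel_measurable_continuous_onI lipschitz_on_continuous_on)
  have 1: "integrable \<gamma> (\<lambda>z. f (fst z))" "(\<integral>y. f y \<partial>\<mu>) = (\<integral>z. f (fst z) \<partial>\<gamma>)"
    using assms(2) unfolding \<mu>[symmetric] by (simp_all add: integrable_distr_eq integral_distr)
  have 2: "integrable \<gamma> (\<lambda>z. f (snd z))" "(\<integral>y. f y \<partial>\<nu>) = (\<integral>z. f (snd z) \<partial>\<gamma>)"
    using assms(3) unfolding \<nu>[symmetric] by (simp_all add: integrable_distr_eq integral_distr)
  have "ennreal \<bar>(\<integral>y. f y \<partial>\<mu>) - (\<integral>y. f y \<partial>\<nu>)\<bar> = ennreal (norm (\<integral>z. f (fst z) - f (snd z) \<partial>\<gamma>))"
    using 1 2 by simp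
  also have "\<dots> \<le> (\<integral>\<^sup>+z. ennreal (norm (f (fst z) - f (snd z))) \<partial>\<gamma>)"
    using 1 2 by (intro integral_norm_bound_ennreal) auto
  also have "\<dots> \<le> (\<integral>\<^sup>+z. ennreal (dist (fst z) (snd z)) \<partial>\<gamma>)"
    using lipschitz_onD[OF f] by (intro nn_integral_mono ennreal_leI) (auto simp: dist_real_def)
  finally show "ennreal \<bar>(\<integral>y. f y \<partial>\<mu>) - (\<integral>y. f y \<partial>\<nu>)\<bar> \<le> (\<integral>\<^sup>+z. ennreal (dist (fst z) (snd z)) \<partial>\<gamma>)" .
qed

lemma lipschitz_dist: "1-lipschitz_on UNIV (\<lambda>y::'a::metric_space. dist y c)"
proof (rule lipschitz_onI)
  show "dist (dist x c) (dist y c) \<le> 1 * dist x y" for x y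
    using abs_dist_diff_le[of x c y] by (simp add: dist_real_def dist_commute)
qed simp

text \<open>The path realises the distance between its ends, so the triangle inequalities along it
  are equalities and the distance from \<open>x\<close> to \<open>p i\<close> is the partial length
  \<open>S i\<close>.\<close>

lemma eps_geodesic_chain:
  fixes x y :: "'a::metric_space"
  assumes "eps_geodesic \<epsilon> TYPE('a)"
  obtains n p where "p 0 = x" "p n = y"
    and "\<And>i. i < n \<Longrightarrow> dist (p i) (p (Suc i)) \<le> \<epsilon>"
    and "\<And>i. i < n \<Longrightarrow> dist x (p (Suc i)) = dist x (p i) + dist (p i) (p (Suc i))"
proof -
  obtain n p where p: "p 0 = x" "p n = y" "\<And>i. i < n \<Longrightarrow> dist (p i) (p (Suc i)) \<le> \<epsilon>"
    and sum: "dist x y = (\<Sum>i<n. dist (p i) (p (Suc i)))"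
    using assms unfolding eps_geodesic_def by metis
  define S where "S i = (\<Sum>j<i. dist (p j) (p (Suc j)))" for i
  have le: "dist (p i) (p (i + k)) \<le> S (i + k) - S i" for i k
  proof (induction k)
    case (Suc k)
    then show ?case using dist_triangle[of "p i" "p (Suc (i + k))" "p (i + k)"] by (simp add: S_def)
  qed simp
  have eq: "dist x (p i) = S i" if "i \<le> n" for i
  proof (rule antisym)
    show "dist x (p i) \<le> S i" using le[of 0 i] by (simp add: p S_def)
    have "dist (p i) y \<le> S n - S i" using le[of i "n - i"] that by (simp add: p)
    then show "S i \<le> dist x (p i)" using dist_triangle[of x y "p i"] sum by (simp add: S_def)
  qed
  have step: "dist x (p (Suc i)) = dist x (p i) + dist (p i) (p (Suc i))" if "i < n" for i
    using eq[of i] eq[of "Suc i"] that by (simp add: S_def)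
  show thesis by (rule that[OF p step])
qed

section \<open>Expected distance to the base point after one step\<close>

locale nonneg_curved_chain =
  fixes P :: "'a::polish_space \<Rightarrow> 'a measure" and \<epsilon> \<rho> s :: real and x0 :: 'a
    and K :: "real \<Rightarrow> real"
  assumes \<epsilon>_pos: "\<epsilon> > 0"
    and geodesic: "eps_geodesic \<epsilon> TYPE('a)"
    and kernel: "markov_kernel P"
    and \<rho>_pos: "\<rho> > 0"
    and attraction: "\<And>x. \<epsilon> < dist x x0 \<Longrightarrow> dist x x0 \<le> 2 * \<epsilon> \<Longrightarrow>
           enn2ereal (W1 (return borel x0) (P x)) \<le> ereal (dist x0 x - \<rho>)"
    and antimono: "antimono_on {0..} K"
    and nonneg: "\<And>r. r \<ge> 0 \<Longrightarrow> K r \<ge> 0"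
    and curvature: "\<And>x. local_coarse_ricci P \<epsilon> x \<ge> ereal (K (dist x x0))"
    and s_pos: "s > 0"
    and gaussian: "\<And>x. gaussian_exp_moments s (P x)"
begin

lemma prob_space_P: "prob_space (P x)" and sets_P [simp, measurable_cong]: "sets (P x) = sets borel"
proof -
  have "P x \<in> space (prob_algebra borel)"
    using kernel measurable_space[of P borel "prob_algebra borel" x] by (simp add: markov_kernel_def)
  then show "prob_space (P x)" "sets (P x) = sets borel" by (auto simp: space_prob_algebra)
qed

definition mean :: "'a \<Rightarrow> real" where "mean x = (\<integral>y. dist y x0 \<partial>P x)"

lemma integrable_dist: "integrable (P x) (\<lambda>y. dist y x0)"
  using gaussian[of x] lipschitz_dist[of x0] unfolding gaussian_exp_moments_def by blast

text \<open>Solving the curvature bound for \<open>W1\<close> gives the contraction;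
  \<open>W1 \<ge> 0\<close> gives \<open>K \<le> 1\<close>, but only at radii of points that have a
  neighbour within \<epsilon>.\<close>

lemma curvature_W1:
  assumes "0 < dist x y" "dist x y \<le> \<epsilon>"
  shows "W1 (P x) (P y) \<le> ennreal (dist x y * (1 - K (dist x x0)))" and "K (dist x x0) \<le> 1"
proof -
  define w where "w = W1 (P x) (P y)"
  define d where "d = dist x y"
  have d: "d > 0" using assms by (simp add: d_def)
  have "ereal (K (dist x x0)) \<le> coarse_ricci P x y"
    using curvature[of x] assms unfolding local_coarse_ricci_def by (auto simp: le_INF_iff)
  then have le: "ereal (K (dist x x0)) \<le> 1 - enn2ereal w / ereal d"
    by (simp add: coarse_ricci_def w_def d_def)
  show "W1 (P x) (P y) \<le> ennreal (dist x y * (1 - K (dist x x0)))" and "K (dist x x0) \<le> 1"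
    unfolding w_def[symmetric] d_def[symmetric]
  proof -
    \<comment> \<open>An infinite \<open>w\<close> would make the right side of \<open>le\<close>
      equal to -\<infinity>, below any real number.\<close>
    obtain c where c: "c \<ge> 0" "w = ennreal c"
      using le d by (cases w) (auto simp: one_ereal_def)
    then have *: "K (dist x x0) \<le> 1 - c / d" using le d by (simp add: one_ereal_def)
    moreover have "c / d \<ge> 0" using c d by simp
    ultimately show "K (dist x x0) \<le> 1" by linarith
    have "c \<le> d * (1 - K (dist x x0))" using * d by (simp add: field_simps)
    then show "w \<le> ennreal (d * (1 - K (dist x x0)))" using c by (simp add: ennreal_leI)
  qed
qed

text \<open>\<open>K\<close> is taken at the starting point \<open>x\<close>. On a path leading away
  from \<open>x0\<close> this is the inner endpoint, where \<open>K\<close> is larger and dominates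
  the growth rate of \<open>J\<close> along the link.\<close>

lemma mean_step:
  assumes "dist x y \<le> \<epsilon>"
  shows "mean y \<le> mean x + dist x y * (1 - K (dist x x0))"
proof (cases "x = y")
  case False
  have "ennreal \<bar>mean x - mean y\<bar> \<le> W1 (P x) (P y)"
    unfolding mean_def by (intro W1_lipschitz lipschitz_dist integrable_dist)
  also have "\<dots> \<le> ennreal (dist x y * (1 - K (dist x x0)))"
    using False assms by (intro curvature_W1) auto
  finally show ?thesis
    using curvature_W1(2)[of x y] False assms by (simp add: ennreal_le_iff)
qed simp

text \<open>By \<open>K \<ge> 0\<close>, \<open>mean\<close> grows along each geodesic link by at
  most its length. This will carry the annulus estimate to points within \<epsilon> of
  \<open>x0\<close>, about which \<open>attraction\<close> says nothing.\<close>

lemma mean_lipschitz: "mean y \<le> mean x + dist x y"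
proof -
  obtain n p where p: "p 0 = x" "p n = y" "\<And>i. i < n \<Longrightarrow> dist (p i) (p (Suc i)) \<le> \<epsilon>"
    "\<And>i. i < n \<Longrightarrow> dist x (p (Suc i)) = dist x (p i) + dist (p i) (p (Suc i))"
    by (rule eps_geodesic_chain[OF geodesic, of x y]) (rule that)
  have "mean (p i) \<le> mean x + dist x (p i)" if "i \<le> n" for i
    using that
  proof (induction i)
    case (Suc i)
    have "mean (p (Suc i)) \<le> mean (p i) + dist (p i) (p (Suc i)) * (1 - K (dist (p i) x0))"
      using Suc by (intro mean_step p) auto
    moreover have "dist (p i) (p (Suc i)) * K (dist (p i) x0) \<ge> 0" by (simp add: nonneg)
    ultimately show ?case using Suc p(4)[of i] by (simp add: algebra_simps)
  qed (simp add: p)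
  then show ?thesis using p by blast
qed

lemma mean_annulus:
  assumes "\<epsilon> < dist x x0" "dist x x0 \<le> 2 * \<epsilon>"
  shows "mean x \<le> dist x x0 - \<rho>"
proof -
  define w where "w = W1 (return borel x0) (P x)"
  have "ennreal \<bar>(\<integral>y. dist y x0 \<partial>return borel x0) - mean x\<bar> \<le> w"
    unfolding mean_def w_def
    by (intro W1_lipschitz lipschitz_dist integrable_dist)
      (simp add: integrable_iff_bounded nn_integral_return)
  \<comment> \<open>Under the Dirac mass at \<open>x0\<close> the mean distance to \<open>x0\<close>
    is 0.\<close>
  then have 1: "ennreal \<bar>mean x\<bar> \<le> w" by (simp add: integral_return)
  have 2: "enn2ereal w \<le> ereal (dist x x0 - \<rho>)" using attraction[OF assms] by (simp add: w_def dist_commute)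
  from 2 obtain c where "c \<ge> 0" "w = ennreal c" by (cases w) auto
  with 1 2 show ?thesis by (simp add: ennreal_le_iff)
qed

end

text \<open>A point beyond \<epsilon> yields a neighbour of \<open>x0\<close>, hence
  \<open>K \<le> 1\<close>, and a point in the annulus governed by \<open>attraction\<close>.
  Without such a point the tail event is empty.\<close>

locale far_reaching_chain = nonneg_curved_chain +
  assumes far: "\<exists>y. \<epsilon> < dist y x0"
begin

lemma K_le_one: assumes "r \<ge> 0" shows "K r \<le> 1"
proof -
  obtain y where y: "\<epsilon> < dist y x0" using far ..
  obtain n p where p: "p 0 = x0" "p n = y" "\<And>i. i < n \<Longrightarrow> dist (p i) (p (Suc i)) \<le> \<epsilon>"
    "\<And>i. i < n \<Longrightarrow> dist x0 (p (Suc i)) = dist x0 (p i) + dist (p i) (p (Suc i))"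
    by (rule eps_geodesic_chain[OF geodesic, of x0 y]) (rule that)
  \<comment> \<open>Paths may repeat points, so the first vertex other than \<open>x0\<close> is
    chosen: its predecessor is \<open>x0\<close>, which puts it within \<epsilon> of
    \<open>x0\<close>.\<close>
  define j where "j = (LEAST i. p i \<noteq> x0)"
  have n: "p n \<noteq> x0" using y p(2) \<epsilon>_pos by auto
  have j: "p j \<noteq> x0" "j \<le> n" using n unfolding j_def by (fact LeastI, fact Least_le)
  then obtain i where i: "j = Suc i" using p(1) by (cases j) auto
  have "p i = x0" using not_less_Least[of i "\<lambda>i. p i \<noteq> x0"] i by (auto simp: j_def)
  then have "0 < dist x0 (p j)" "dist x0 (p j) \<le> \<epsilon>" using j p(3)[of i] i by auto
  then have "K 0 \<le> 1" using curvature_W1(2)[of x0] by auto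
  then show ?thesis using antimono assms by (force simp: monotone_on_def)
qed

sublocale rate_profile K "2 * \<epsilon>"
  by unfold_locales (use \<epsilon>_pos antimono nonneg K_le_one in auto)

text \<open>The first vertex \<open>p j\<close> beyond radius \<epsilon> follows a vertex of radius
  at most \<epsilon> by a link of length at most \<epsilon>, so it cannot jump over the
  annulus.\<close>

lemma chain_through_annulus:
  assumes "\<epsilon> < dist x x0"
  obtains n p j where "p n = x" "j \<le> n" "\<epsilon> < dist (p j) x0" "dist (p j) x0 \<le> 2 * \<epsilon>"
    and "\<And>i. i < n \<Longrightarrow> dist (p i) (p (Suc i)) \<le> \<epsilon>"
    and "\<And>i. i < n \<Longrightarrow> dist (p (Suc i)) x0 = dist (p i) x0 + dist (p i) (p (Suc i))"
proof -
  obtain n p where p: "p 0 = x0" "p n = x" "\<And>i. i < n \<Longrightarrow> dist (p i) (p (Suc i)) \<le> \<epsilon>"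
    and add: "\<And>i. i < n \<Longrightarrow> dist x0 (p (Suc i)) = dist x0 (p i) + dist (p i) (p (Suc i))"
    by (rule eps_geodesic_chain[OF geodesic, of x0 x]) (rule that)
  define j where "j = (LEAST i. \<epsilon> < dist (p i) x0)"
  have n: "\<epsilon> < dist (p n) x0" using assms p by simp
  have j: "\<epsilon> < dist (p j) x0" "j \<le> n" using n unfolding j_def by (fact LeastI, fact Least_le)
  then obtain i where i: "j = Suc i" using p(1) \<epsilon>_pos by (cases j) auto
  have "dist (p i) x0 \<le> \<epsilon>" using not_less_Least[of i "\<lambda>i. \<epsilon> < dist (p i) x0"] i by (auto simp: j_def)
  then have "dist (p j) x0 \<le> 2 * \<epsilon>" using add[of i] p(3)[of i] i j by (simp add: dist_commute)
  then show thesis using that[of p n j] j p add by (simp add: dist_commute)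
qed

text \<open>Induction outwards from the annulus, where \<open>J\<close> is 0: a link of length
  \<open>d\<close> raises \<open>mean\<close> by at most \<open>d * (1 - K)\<close> and
  \<open>J\<close> by at most \<open>d * K\<close>, with \<open>K\<close> taken at the inner
  endpoint.\<close>

lemma mean_drift:
  assumes "\<epsilon> < dist x x0"
  shows "mean x \<le> dist x x0 - (\<rho> + J (dist x x0))"
proof -
  obtain n p j where p: "p n = x" "j \<le> n" "\<epsilon> < dist (p j) x0" "dist (p j) x0 \<le> 2 * \<epsilon>"
    "\<And>i. i < n \<Longrightarrow> dist (p i) (p (Suc i)) \<le> \<epsilon>"
    "\<And>i. i < n \<Longrightarrow> dist (p (Suc i)) x0 = dist (p i) x0 + dist (p i) (p (Suc i))"
    by (rule chain_through_annulus[OF assms]) (rule that)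
  have "i \<le> n \<longrightarrow> mean (p i) \<le> dist (p i) x0 - (\<rho> + J (dist (p i) x0))" if "j \<le> i" for i
    using that
  proof (induction rule: dec_induct)
    case base
    then show ?case using mean_annulus[OF p(3,4)] p(4) by (simp add: J_eq_0)
  next
    case (step i)
    show ?case
    proof
      assume "Suc i \<le> n"
      then have i: "i < n" by simp
      have "mean (p (Suc i)) \<le> mean (p i) + dist (p i) (p (Suc i)) * (1 - K (dist (p i) x0))"
        by (intro mean_step p i)
      moreover have "J (dist (p (Suc i)) x0) - J (dist (p i) x0)
          \<le> (dist (p (Suc i)) x0 - dist (p i) x0) * K (dist (p i) x0)"
        using p(6)[OF i] by (intro J_diff_le) auto
      ultimately show "mean (p (Suc i)) \<le> dist (p (Suc i)) x0 - (\<rho> + J (dist (p (Suc i)) x0))"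
        using step.IH i p(6)[OF i] by (simp add: algebra_simps)
    qed
  qed
  then show ?thesis using p by auto
qed

text \<open>Comparison with an annulus point \<open>z\<close>:
  \<open>2 * \<epsilon> - \<rho>\<close> bounds \<open>mean z\<close> and
  \<open>3 * \<epsilon>\<close> bounds \<open>dist z x\<close>.\<close>

lemma mean_near:
  assumes "dist x x0 \<le> \<epsilon>"
  shows "mean x \<le> 5 * \<epsilon> - \<rho>"
proof -
  obtain z where z: "\<epsilon> < dist z x0" "dist z x0 \<le> 2 * \<epsilon>"
    using far by (blast elim: chain_through_annulus)
  have "mean x \<le> mean z + dist z x" by (rule mean_lipschitz)
  moreover have "dist z x \<le> dist z x0 + dist x x0"
    by (simp add: dist_triangle2)
  ultimately show ?thesis using mean_annulus[OF z] z assms by linarith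
qed

end

section \<open>Lyapunov function\<close>

text \<open>Formally, integrate the two one-step bounds against \<open>\<pi>\<close> and subtract.
  Since \<open>V\<close> is not known to be integrable, \<open>V\<close> is truncated at
  \<open>N\<close> and the integral of the bounded function \<open>W\<close> is subtracted
  instead.\<close>

lemma stationary_lyapunov_bound:
  fixes V :: "'a \<Rightarrow> real"
  assumes P [measurable]: "P \<in> M \<rightarrow>\<^sub>M prob_algebra M"
    and \<pi>: "\<pi> \<in> space (prob_algebra M)" and stationary: "\<pi> \<bind> P = \<pi>"
    and V [measurable]: "V \<in> borel_measurable M" and A [measurable]: "A \<in> sets M"
    and V_nonneg: "\<And>x. V x \<ge> 0" and q: "0 \<le> q" "q < 1" and c: "c \<ge> 0"
    and decay: "\<And>x. x \<in> A \<Longrightarrow> (\<integral>\<^sup>+y. ennreal (V y) \<partial>P x) \<le> ennreal (q * V x)"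
    and bounded: "\<And>x. x \<in> space M - A \<Longrightarrow> (\<integral>\<^sup>+y. ennreal (V y) \<partial>P x) \<le> ennreal c"
  shows "(\<integral>\<^sup>+x. ennreal (V x) * indicator A x \<partial>\<pi>) \<le> ennreal (c / (1 - q))"
proof -
  have [measurable_cong]: "sets \<pi> = sets M" and "prob_space \<pi>"
    using \<pi> by (auto simp: space_prob_algebra)
  then have space: "space \<pi> = space M" by (intro sets_eq_imp_space_eq)
  interpret prob_space \<pi> by fact
  have P': "P \<in> M \<rightarrow>\<^sub>M subprob_algebra M" by (rule measurable_prob_algebraD) fact
  have sets_P: "sets (P x) = sets M" and prob_P: "prob_space (P x)" if "x \<in> space M" for x
    using measurable_space[OF P that] by (auto simp: space_prob_algebra)
  define B where "B N = {x \<in> A. V x \<le> real N}" for N :: nat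
  have B [measurable]: "B N \<in> sets M" for N
    unfolding B_def using sets.sets_into_space[OF A] by measurable
  have trunc: "(\<integral>\<^sup>+x. ennreal ((1 - q) * V x) * indicator (B N) x \<partial>\<pi>) \<le> ennreal c" for N
  proof -
    define W where "W x = ennreal (min (q * V x) (real N)) * indicator A x" for x
    have W [measurable]: "W \<in> borel_measurable M" unfolding W_def by measurable
    have "(\<integral>\<^sup>+x. W x \<partial>\<pi>) \<le> (\<integral>\<^sup>+x. ennreal (real N) \<partial>\<pi>)"
      by (intro nn_integral_mono) (auto simp: W_def indicator_def intro!: ennreal_leI)
    \<comment> \<open>Finiteness is what allows this integral to be cancelled from both sides at the
      end.\<close>
    then have fin: "(\<integral>\<^sup>+x. W x \<partial>\<pi>) \<noteq> \<infinity>"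
      by (auto simp: emeasure_space_1 top_unique)
    have "(\<integral>\<^sup>+x. W x \<partial>\<pi>) + (\<integral>\<^sup>+x. ennreal ((1 - q) * V x) * indicator (B N) x \<partial>\<pi>)
        = (\<integral>\<^sup>+x. W x + ennreal ((1 - q) * V x) * indicator (B N) x \<partial>\<pi>)"
      by (intro nn_integral_add[symmetric]) measurable
    also have "\<dots> \<le> (\<integral>\<^sup>+x. ennreal (min (V x) (real N)) \<partial>\<pi>)"
    proof (intro nn_integral_mono)
      \<comment> \<open>On \<open>B N\<close> the truncation is inactive and the two sides agree;
        elsewhere \<open>q * V x \<le> V x\<close> suffices.\<close>
      fix x
      have "q * V x \<le> V x" using q V_nonneg[of x] mult_right_mono[of q 1 "V x"] by simp
      then have "min (q * V x) (real N) \<le> min (V x) (real N)"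
        and "V x \<le> real N \<Longrightarrow> min (q * V x) (real N) + (1 - q) * V x = min (V x) (real N)"
        by (auto simp: algebra_simps)
      then show "W x + ennreal ((1 - q) * V x) * indicator (B N) x \<le> ennreal (min (V x) (real N))"
        using q V_nonneg[of x]
        by (auto simp: W_def B_def indicator_def simp flip: ennreal_plus intro!: ennreal_leI)
    qed
    \<comment> \<open>Invariance of \<open>\<pi>\<close>, applied to the truncated function.\<close>
    also have "\<dots> = (\<integral>\<^sup>+x. (\<integral>\<^sup>+y. ennreal (min (V y) (real N)) \<partial>P x) \<partial>\<pi>)"
      by (subst stationary[symmetric], rule nn_integral_bind[where B = M])
        (use P' in \<open>auto cong: measurable_cong_sets simp: \<open>sets \<pi> = sets M\<close>\<close>)
    also have "\<dots> \<le> (\<integral>\<^sup>+x. W x + ennreal c \<partial>\<pi>)"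
    proof (intro nn_integral_mono)
      fix x assume "x \<in> space \<pi>"
      then have x: "x \<in> space M" by (simp add: space)
      interpret Px: prob_space "P x" using prob_P[OF x] .
      have 1: "(\<integral>\<^sup>+y. ennreal (min (V y) (real N)) \<partial>P x) \<le> (\<integral>\<^sup>+y. ennreal (V y) \<partial>P x)"
        by (intro nn_integral_mono ennreal_leI) auto
      have "(\<integral>\<^sup>+y. ennreal (min (V y) (real N)) \<partial>P x) \<le> (\<integral>\<^sup>+y. ennreal (real N) \<partial>P x)"
        by (intro nn_integral_mono ennreal_leI) auto
      then have 2: "(\<integral>\<^sup>+y. ennreal (min (V y) (real N)) \<partial>P x) \<le> ennreal (real N)"
        by (simp add: Px.emeasure_space_1)
      show "(\<integral>\<^sup>+y. ennreal (min (V y) (real N)) \<partial>P x) \<le> W x + ennreal c"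
      proof (cases "x \<in> A")
        case True
        have "(\<integral>\<^sup>+y. ennreal (min (V y) (real N)) \<partial>P x) \<le> W x"
          using 1 2 decay[OF True] True by (auto simp: W_def min_def)
        then show ?thesis by (simp add: add_increasing2)
      next
        case False
        then show ?thesis using 1 bounded[of x] x by (auto simp: W_def)
      qed
    qed
    also have "\<dots> = (\<integral>\<^sup>+x. W x \<partial>\<pi>) + ennreal c"
      by (subst nn_integral_add) (simp_all add: emeasure_space_1)
    finally show ?thesis using fin by (simp add: ennreal_add_left_cancel_le)
  qed
  have "ennreal (1 - q) * (\<integral>\<^sup>+x. ennreal (V x) * indicator A x \<partial>\<pi>)
      = (\<integral>\<^sup>+x. ennreal ((1 - q) * V x) * indicator A x \<partial>\<pi>)"
    using q V_nonneg by (subst nn_integral_cmult[symmetric]) (auto simp: ennreal_mult mult.assoc)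
  \<comment> \<open>The sets \<open>B N\<close> increase to \<open>A\<close>, so monotone
    convergence removes the truncation.\<close>
  also have "\<dots> = (\<integral>\<^sup>+x. (SUP N. ennreal ((1 - q) * V x) * indicator (B N) x) \<partial>\<pi>)"
  proof (intro nn_integral_cong antisym)
    fix x
    obtain N :: nat where "V x \<le> real N" using real_arch_simple by blast
    then have "ennreal ((1 - q) * V x) * indicator A x = ennreal ((1 - q) * V x) * indicator (B N) x"
      by (simp add: B_def indicator_def)
    then show "ennreal ((1 - q) * V x) * indicator A x \<le> (SUP N. ennreal ((1 - q) * V x) * indicator (B N) x)"
      by (auto intro: SUP_upper2)
    show "(SUP N. ennreal ((1 - q) * V x) * indicator (B N) x) \<le> ennreal ((1 - q) * V x) * indicator A x"
      by (intro SUP_least) (auto simp: B_def indicator_def)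
  qed
  also have "\<dots> = (SUP N. \<integral>\<^sup>+x. ennreal ((1 - q) * V x) * indicator (B N) x \<partial>\<pi>)"
    by (intro nn_integral_monotone_convergence_SUP)
      (auto simp: incseq_def le_fun_def B_def indicator_def)
  also have "\<dots> \<le> ennreal c" by (intro SUP_least trunc)
  finally have le: "ennreal (1 - q) * (\<integral>\<^sup>+x. ennreal (V x) * indicator A x \<partial>\<pi>) \<le> ennreal c" .
  have "(\<integral>\<^sup>+x. ennreal (V x) * indicator A x \<partial>\<pi>)
      = ennreal (1 / (1 - q)) * (ennreal (1 - q) * (\<integral>\<^sup>+x. ennreal (V x) * indicator A x \<partial>\<pi>))"
    using q by (simp add: mult.assoc[symmetric] flip: ennreal_mult)
  also have "\<dots> \<le> ennreal (1 / (1 - q)) * ennreal c" using le by (intro mult_left_mono) auto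
  also have "\<dots> = ennreal (c / (1 - q))" using q c by (simp flip: ennreal_mult)
  finally show ?thesis .
qed

text \<open>Equivalent to \<open>2 powr (- k) \<le> 1 - k / 2\<close>, the chord bound for the
  convex exponential between 0 and \<open>- ln 2\<close>. This is the origin of \<open>ln 2\<close>
  in the threshold.\<close>

lemma inverse_sqrt_le_exp:
  fixes k :: real
  assumes "0 \<le> k" "k \<le> 1"
  shows "1 / sqrt (1 - k / 2) \<le> exp (k * ln 2 / 2)"
proof -
  have "exp ((1 - k) *\<^sub>R 0 + k *\<^sub>R (- ln 2)) \<le> (1 - k) * exp 0 + k * exp (- ln 2 :: real)"
    using assms by (intro convex_onD[OF exp_convex]) auto
  then have "exp (- (k * ln 2 / 2)) ^ 2 \<le> 1 - k / 2"
    by (simp add: exp_minus field_simps flip: exp_double)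
  then have "exp (- (k * ln 2 / 2)) \<le> sqrt (1 - k / 2)"
    by (rule real_le_rsqrt)
  then have "1 / sqrt (1 - k / 2) \<le> 1 / exp (- (k * ln 2 / 2))"
    using assms by (intro divide_left_mono) auto
  then show ?thesis by (simp add: exp_minus field_simps)
qed

text \<open>The weights \<open>(2 - 2 * k) / (2 - k)\<close> and \<open>k / (2 - k)\<close> of \<open>\<phi>\<close> and \<open>h\<close> in the coefficient of \<open>h\<close>
  add up to 1, which is where \<open>max h \<phi>\<close> comes from.\<close>
lemma exponent_bound:
  fixes k \<phi> h :: real
  assumes k: "0 \<le> k" "k \<le> 1" and h: "h \<ge> 0"
  shows "\<phi> * (h - \<phi>) + k * (h - \<phi>)\<^sup>2 / 2 + (\<phi> + k * (h - \<phi>))\<^sup>2 / (4 * (1 - k / 2))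
    \<le> - (\<phi>\<^sup>2 / 2) + h * max h \<phi>"
proof -
  have "\<phi> * (h - \<phi>) + k * (h - \<phi>)\<^sup>2 / 2 + (\<phi> + k * (h - \<phi>))\<^sup>2 / (4 * (1 - k / 2))
      = - \<phi>\<^sup>2 * (1 - 1 / (2 * (2 - k))) + h * ((2 - 2 * k) / (2 - k) * \<phi> + k / (2 - k) * h)"
    using k by (simp add: power2_eq_square divide_simps) (simp add: algebra_simps)
  also have "\<dots> \<le> - \<phi>\<^sup>2 * (1 / 2) + h * ((2 - 2 * k) / (2 - k) * max h \<phi> + k / (2 - k) * max h \<phi>)"
  proof (rule add_mono)
    \<comment> \<open>\<open>k \<le> 1\<close> makes \<open>2 * (2 - k)\<close> at least 2.\<close>
    have "1 / 2 \<le> 1 - 1 / (2 * (2 - k))" using k by (simp add: field_simps)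
    then show "- \<phi>\<^sup>2 * (1 - 1 / (2 * (2 - k))) \<le> - \<phi>\<^sup>2 * (1 / 2)"
      by (rule mult_left_mono_neg) simp
  qed (use k h in \<open>intro mult_left_mono add_mono, auto\<close>)
  also have "(2 - 2 * k) / (2 - k) * max h \<phi> + k / (2 - k) * max h \<phi> = max h \<phi>"
    using k by (simp add: divide_simps flip: distrib_right add_divide_distrib)
  finally show ?thesis by simp
qed

section \<open>Contraction of the Lyapunov function and the tail bound\<close>

context far_reaching_chain
begin

definition \<Phi> :: "real \<Rightarrow> real" where "\<Phi> u = \<rho> * u + G u"

definition r0 :: real where "r0 = 2 * \<epsilon> + ln 2 * s\<^sup>2 / \<rho>"

definition V :: "'a \<Rightarrow> real" where "V x = exp (\<Phi> (dist x x0) / (2 * s\<^sup>2))"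

lemma Phi_eq: "Phi \<epsilon> \<rho> K u = \<Phi> u"
  by (simp add: Phi_def \<Phi>_def G_def J_def[abs_def])

lemma r0_gt: "2 * \<epsilon> < r0"
  using \<rho>_pos s_pos by (simp add: r0_def)

lemma \<Phi>_mono: "u \<le> v \<Longrightarrow> \<Phi> u \<le> \<Phi> v"
  unfolding \<Phi>_def using \<rho>_pos by (intro add_mono mult_left_mono G_mono) auto

lemma V_nonneg: "V x \<ge> 0"
  by (simp add: V_def)

lemma V_measurable [measurable]: "V \<in> borel_measurable borel"
proof -
  have [measurable]: "\<Phi> \<in> borel_measurable borel"
    by (rule borel_measurable_mono) (simp add: mono_def \<Phi>_mono)
  show ?thesis unfolding V_def by measurable
qed

text \<open>The reference radius \<open>r\<close>, where the parabola touches \<open>\<Phi>\<close>,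
  is decoupled from the radius of \<open>x\<close>, and \<open>h\<close> is the allowed excess of
  the mean. Far points use their own radius with \<open>h = 0\<close>; points of the central ball
  use \<open>r0\<close> with \<open>h = 3 * \<epsilon>\<close>.\<close>

lemma V_one_step:
  assumes r: "r0 \<le> r" and h: "h \<ge> 0" and mean: "mean x \<le> r - (\<rho> + J r) + h"
  shows "(\<integral>\<^sup>+y. ennreal (V y) \<partial>P x)
    \<le> ennreal (exp (- (\<rho>\<^sup>2 / (4 * s\<^sup>2)) + \<Phi> r / (2 * s\<^sup>2) + h * max h (\<rho> + J r) / (2 * s\<^sup>2)))"
proof -
  define \<phi> where "\<phi> = \<rho> + J r"
  define k where "k = J r / (r - 2 * \<epsilon>)"
  \<comment> \<open>\<open>r + g\<close> is the upper bound on the mean. After recentring the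
    parabola there and dividing by \<open>2 * s\<^sup>2\<close>, \<open>\<alpha>\<close> and
    \<open>a\<close> are the coefficients of the deviation and its square;
    \<open>2 * a * s\<^sup>2 = k / 2 < 1\<close> admits the quadratic moment bound.\<close>
  define g where "g = h - \<phi>"
  define \<alpha> where "\<alpha> = (\<phi> + k * g) / (2 * s\<^sup>2)"
  define a where "a = k / (4 * s\<^sup>2)"
  have r': "2 * \<epsilon> < r" using r r0_gt by simp
  have s2: "s\<^sup>2 > 0" using s_pos by simp
  have k: "0 \<le> k" "k \<le> 1"
    using r' J_nonneg[of r] J_diff_le_length[of "2 * \<epsilon>" r] by (auto simp: k_def J_eq_0)
  have a: "a \<ge> 0" "2 * a * s\<^sup>2 = k / 2" using k s2 by (auto simp: a_def field_simps)
  have pointwise: "V y \<le> exp ((\<Phi> r + \<phi> * g + k * g\<^sup>2 / 2) / (2 * s\<^sup>2))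
      * exp (\<alpha> * (dist y x0 - mean x) + a * (dist y x0 - mean x)\<^sup>2)" for y
  proof -
    define z where "z = dist y x0 - mean x"
    have "\<Phi> (dist y x0) \<le> \<Phi> (r + g + z)"
      using mean by (intro \<Phi>_mono) (simp add: z_def g_def \<phi>_def)
    also have "\<dots> \<le> \<Phi> r + \<phi> * (g + z) + k * (g + z)\<^sup>2 / 2"
      using G_quadratic_majorant[OF r', of "r + g + z"]
      by (simp add: \<Phi>_def \<phi>_def k_def algebra_simps)
    also have "\<dots> = (\<Phi> r + \<phi> * g + k * g\<^sup>2 / 2) + ((\<phi> + k * g) * z + k / 2 * z\<^sup>2)"
      by (simp add: power2_eq_square field_simps)
    finally have "\<Phi> (dist y x0) / (2 * s\<^sup>2)
      \<le> ((\<Phi> r + \<phi> * g + k * g\<^sup>2 / 2) + ((\<phi> + k * g) * z + k / 2 * z\<^sup>2)) / (2 * s\<^sup>2)"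
      using s2 by (intro divide_right_mono) auto
    also have "\<dots> = (\<Phi> r + \<phi> * g + k * g\<^sup>2 / 2) / (2 * s\<^sup>2) + (\<alpha> * z + a * z\<^sup>2)"
      using s2 by (simp add: \<alpha>_def a_def field_simps)
    finally show ?thesis by (simp add: V_def z_def flip: exp_add)
  qed
  have "(\<integral>\<^sup>+y. ennreal (V y) \<partial>P x) \<le> (\<integral>\<^sup>+y. ennreal (exp ((\<Phi> r + \<phi> * g + k * g\<^sup>2 / 2) / (2 * s\<^sup>2)))
      * ennreal (exp (\<alpha> * (dist y x0 - mean x) + a * (dist y x0 - mean x)\<^sup>2)) \<partial>P x)"
    by (intro nn_integral_mono) (simp add: pointwise ennreal_leI flip: ennreal_mult)
  also have "\<dots> = ennreal (exp ((\<Phi> r + \<phi> * g + k * g\<^sup>2 / 2) / (2 * s\<^sup>2))) *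
      (\<integral>\<^sup>+y. ennreal (exp (\<alpha> * (dist y x0 - mean x) + a * (dist y x0 - mean x)\<^sup>2)) \<partial>P x)"
    by (rule nn_integral_cmult) measurable
  also have "\<dots> \<le> ennreal (exp ((\<Phi> r + \<phi> * g + k * g\<^sup>2 / 2) / (2 * s\<^sup>2))) *
      ennreal (exp (\<alpha>\<^sup>2 * s\<^sup>2 / (2 * (1 - 2 * a * s\<^sup>2))) / sqrt (1 - 2 * a * s\<^sup>2))"
    unfolding mean_def using k a
    by (intro mult_left_mono gaussian_exp_moments_quadratic prob_space_P sets_P gaussian lipschitz_dist) auto
  also have "\<dots> \<le> ennreal (exp ((\<Phi> r + \<phi> * g + k * g\<^sup>2 / 2) / (2 * s\<^sup>2)) *
      (exp (\<alpha>\<^sup>2 * s\<^sup>2 / (2 * (1 - k / 2))) * exp (k * ln 2 / 2)))"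
  proof -
    have "exp (\<alpha>\<^sup>2 * s\<^sup>2 / (2 * (1 - k / 2))) * (1 / sqrt (1 - k / 2))
        \<le> exp (\<alpha>\<^sup>2 * s\<^sup>2 / (2 * (1 - k / 2))) * exp (k * ln 2 / 2)"
      by (intro mult_left_mono inverse_sqrt_le_exp k) simp
    then have "exp (\<alpha>\<^sup>2 * s\<^sup>2 / (2 * (1 - k / 2))) / sqrt (1 - k / 2)
        \<le> exp (\<alpha>\<^sup>2 * s\<^sup>2 / (2 * (1 - k / 2))) * exp (k * ln 2 / 2)"
      by simp
    then have "exp ((\<Phi> r + \<phi> * g + k * g\<^sup>2 / 2) / (2 * s\<^sup>2)) *
        (exp (\<alpha>\<^sup>2 * s\<^sup>2 / (2 * (1 - k / 2))) / sqrt (1 - k / 2))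
      \<le> exp ((\<Phi> r + \<phi> * g + k * g\<^sup>2 / 2) / (2 * s\<^sup>2)) *
        (exp (\<alpha>\<^sup>2 * s\<^sup>2 / (2 * (1 - k / 2))) * exp (k * ln 2 / 2))"
      by (rule mult_left_mono) simp
    then show ?thesis
      unfolding a using k by (subst ennreal_mult[symmetric]) (auto intro!: ennreal_leI)
  qed
  also have "\<dots> = ennreal (exp ((\<Phi> r + \<phi> * g + k * g\<^sup>2 / 2) / (2 * s\<^sup>2)
      + \<alpha>\<^sup>2 * s\<^sup>2 / (2 * (1 - k / 2)) + k * ln 2 / 2))"
    by (simp add: exp_add mult.assoc)
  also have "(\<Phi> r + \<phi> * g + k * g\<^sup>2 / 2) / (2 * s\<^sup>2) + \<alpha>\<^sup>2 * s\<^sup>2 / (2 * (1 - k / 2)) + k * ln 2 / 2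
    \<le> - (\<rho>\<^sup>2 / (4 * s\<^sup>2)) + \<Phi> r / (2 * s\<^sup>2) + h * max h (\<rho> + J r) / (2 * s\<^sup>2)"
  proof -
    have "\<alpha>\<^sup>2 * s\<^sup>2 / (2 * (1 - k / 2)) = (\<phi> + k * g)\<^sup>2 / (4 * (1 - k / 2)) / (2 * s\<^sup>2)"
    proof -
      have "(X / (2 * S))\<^sup>2 * S / (2 * D) = X\<^sup>2 / (4 * D) / (2 * S)"
        if "S > 0" "D > 0" for X S D :: real
        using that by (simp add: power2_eq_square field_simps)
      from this[OF s2, of "1 - k / 2"] show ?thesis using k unfolding \<alpha>_def by simp
    qed
    then have "(\<Phi> r + \<phi> * g + k * g\<^sup>2 / 2) / (2 * s\<^sup>2) + \<alpha>\<^sup>2 * s\<^sup>2 / (2 * (1 - k / 2))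
      = (\<Phi> r + (\<phi> * g + k * g\<^sup>2 / 2 + (\<phi> + k * g)\<^sup>2 / (4 * (1 - k / 2)))) / (2 * s\<^sup>2)"
      by (simp add: add_divide_distrib)
    also have "\<dots> \<le> (\<Phi> r + (- (\<phi>\<^sup>2 / 2) + h * max h \<phi>)) / (2 * s\<^sup>2)"
      unfolding g_def using s2 exponent_bound[OF k h, of \<phi>]
      by (intro divide_right_mono add_left_mono) auto
    also have "\<dots> = \<Phi> r / (2 * s\<^sup>2) + h * max h \<phi> / (2 * s\<^sup>2) - \<phi>\<^sup>2 / (4 * s\<^sup>2)"
      by (simp add: add_divide_distrib diff_divide_distrib)
    finally have 1: "(\<Phi> r + \<phi> * g + k * g\<^sup>2 / 2) / (2 * s\<^sup>2) + \<alpha>\<^sup>2 * s\<^sup>2 / (2 * (1 - k / 2))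
      \<le> \<Phi> r / (2 * s\<^sup>2) + h * max h \<phi> / (2 * s\<^sup>2) - \<phi>\<^sup>2 / (4 * s\<^sup>2)" .
    \<comment> \<open>Divided by \<open>4 * s\<^sup>2\<close>, the surplus
      \<open>2 * k * ln 2 * s\<^sup>2\<close> is exactly the \<open>k * ln 2 / 2\<close> lost to the
      square root factor. It comes from the cross term \<open>2 * \<rho> * J r\<close> and the
      choice of \<open>r0\<close>.\<close>
    have "\<rho>\<^sup>2 + 2 * k * ln 2 * s\<^sup>2 \<le> \<phi>\<^sup>2"
    proof -
      have "J r = k * (r - 2 * \<epsilon>)" using r' by (simp add: k_def)
      moreover have "k * (ln 2 * s\<^sup>2 / \<rho>) \<le> k * (r - 2 * \<epsilon>)"
        using r k by (intro mult_left_mono) (auto simp: r0_def)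
      ultimately have "\<rho> * (k * (ln 2 * s\<^sup>2 / \<rho>)) \<le> \<rho> * J r"
        using \<rho>_pos by (intro mult_left_mono) auto
      then have "k * ln 2 * s\<^sup>2 \<le> \<rho> * J r" using \<rho>_pos by (simp add: field_simps)
      moreover have "\<phi>\<^sup>2 = \<rho>\<^sup>2 + 2 * (\<rho> * J r) + (J r)\<^sup>2"
        by (simp add: \<phi>_def power2_sum)
      ultimately show ?thesis using zero_le_power2[of "J r"] by linarith
    qed
    then have "(\<rho>\<^sup>2 + 2 * k * ln 2 * s\<^sup>2) / (4 * s\<^sup>2) \<le> \<phi>\<^sup>2 / (4 * s\<^sup>2)"
      using s2 by (intro divide_right_mono) auto
    moreover have "(\<rho>\<^sup>2 + 2 * k * ln 2 * s\<^sup>2) / (4 * s\<^sup>2) = \<rho>\<^sup>2 / (4 * s\<^sup>2) + k * ln 2 / 2"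
      using s2 by (simp add: field_simps)
    ultimately show ?thesis using 1 by (simp add: \<phi>_def)
  qed
  finally show ?thesis by (simp add: ennreal_leI)
qed

lemma V_decay:
  assumes "r0 \<le> dist x x0"
  shows "(\<integral>\<^sup>+y. ennreal (V y) \<partial>P x) \<le> ennreal (exp (- (\<rho>\<^sup>2 / (4 * s\<^sup>2))) * V x)"
proof -
  have "mean x \<le> dist x x0 - (\<rho> + J (dist x x0)) + 0"
    using mean_drift[of x] assms r0_gt \<epsilon>_pos by simp
  from V_one_step[OF assms order_refl this] show ?thesis by (simp add: V_def flip: exp_add)
qed

text \<open>The value of \<open>V_one_step\<close> at \<open>r0\<close> with
  \<open>h = 3 * \<epsilon>\<close>, after replacing \<open>J r0\<close> by its upper bound
  \<open>ln 2 * s\<^sup>2 / \<rho>\<close>.\<close>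

definition bound :: real where
  "bound = exp (- (\<rho>\<^sup>2 / (4 * s\<^sup>2)) + \<Phi> r0 / (2 * s\<^sup>2)
     + 3 * \<epsilon> * max (3 * \<epsilon>) (\<rho> + ln 2 * s\<^sup>2 / \<rho>) / (2 * s\<^sup>2))"

lemma bound_nonneg: "bound \<ge> 0"
  by (simp add: bound_def)

lemma V_bounded:
  assumes x: "dist x x0 \<le> r0"
  shows "(\<integral>\<^sup>+y. ennreal (V y) \<partial>P x) \<le> ennreal bound"
proof -
  have J: "J r0 - J u \<le> r0 - u" if "u \<le> r0" for u using that by (rule J_diff_le_length)
  have "mean x \<le> r0 - (\<rho> + J r0) + 3 * \<epsilon>"
  proof (cases "\<epsilon> < dist x x0")
    case True
    then show ?thesis using mean_drift[of x] J[of "dist x x0"] x \<epsilon>_pos by simp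
  next
    case False
    \<comment> \<open>Source of the excess \<open>3 * \<epsilon>\<close>: \<open>u - J u\<close> is
      non-decreasing and equals \<open>2 * \<epsilon>\<close> at \<open>2 * \<epsilon>\<close>, so
      \<open>5 * \<epsilon> - \<rho>\<close> is at most
      \<open>r0 - J r0 - \<rho> + 3 * \<epsilon>\<close>.\<close>
    then show ?thesis using mean_near[of x] J[of "2 * \<epsilon>"] r0_gt by (simp add: J_eq_0)
  qed
  then have "(\<integral>\<^sup>+y. ennreal (V y) \<partial>P x) \<le> ennreal (exp (- (\<rho>\<^sup>2 / (4 * s\<^sup>2)) + \<Phi> r0 / (2 * s\<^sup>2)
      + 3 * \<epsilon> * max (3 * \<epsilon>) (\<rho> + J r0) / (2 * s\<^sup>2)))"
    using \<epsilon>_pos by (intro V_one_step) auto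
  also have "\<dots> \<le> ennreal bound"
  proof -
    have "J r0 \<le> ln 2 * s\<^sup>2 / \<rho>" using J[of "2 * \<epsilon>"] r0_gt by (simp add: J_eq_0 r0_def)
    then have "3 * \<epsilon> * max (3 * \<epsilon>) (\<rho> + J r0) / (2 * s\<^sup>2)
        \<le> 3 * \<epsilon> * max (3 * \<epsilon>) (\<rho> + ln 2 * s\<^sup>2 / \<rho>) / (2 * s\<^sup>2)"
      using \<epsilon>_pos by (intro divide_right_mono mult_left_mono max.mono) auto
    then show ?thesis by (simp add: bound_def ennreal_leI)
  qed
  finally show ?thesis .
qed

lemma C0_eq: "C0 \<epsilon> \<rho> s K = bound / (1 - exp (- (\<rho>\<^sup>2 / (4 * s\<^sup>2))))"
proof -
  have "\<Phi> r0 = \<rho> * (2 * \<epsilon> + ln 2 * s\<^sup>2 / \<rho>)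
      + integral {2*\<epsilon>..2*\<epsilon> + ln 2 * s\<^sup>2 / \<rho>} (\<lambda>u. integral {2*\<epsilon>..u} K)"
    by (simp add: r0_def flip: Phi_eq) (simp add: Phi_def)
  then show ?thesis by (simp add: C0_def bound_def add_divide_distrib add_ac)
qed

lemma concentration:
  assumes l: "r0 < l" and \<pi>: "equilibrium_measure P \<pi>"
  shows "measure \<pi> {x. dist x x0 \<ge> l} \<le> C0 \<epsilon> \<rho> s K * exp (- (1 / (2 * s\<^sup>2)) * Phi \<epsilon> \<rho> K l)"
proof -
  define q where "q = exp (- (\<rho>\<^sup>2 / (4 * s\<^sup>2)))"
  have q: "0 \<le> q" "q < 1" using \<rho>_pos s_pos by (auto simp: q_def)
  have [measurable_cong]: "sets \<pi> = sets borel" and "prob_space \<pi>"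
    using \<pi> by (auto simp: equilibrium_measure_def space_prob_algebra)
  interpret prob_space \<pi> by fact
  define L where "L = {x. dist x x0 \<ge> l}"
  have [measurable]: "L \<in> sets borel" unfolding L_def by measurable
  \<comment> \<open>The level in Markov's inequality: \<open>V \<ge> v\<close> on \<open>L\<close>
    because \<open>\<Phi>\<close> is monotone, and \<open>L\<close> lies in the contraction region
    because \<open>r0 < l\<close>.\<close>
  define v where "v = exp (\<Phi> l / (2 * s\<^sup>2))"
  have "ennreal (v * measure \<pi> L) = ennreal v * emeasure \<pi> L"
    by (simp add: emeasure_eq_measure ennreal_mult v_def)
  also have "\<dots> = (\<integral>\<^sup>+x. ennreal v * indicator L x \<partial>\<pi>)"
    by (simp add: nn_integral_cmult_indicator)
  also have "\<dots> \<le> (\<integral>\<^sup>+x. ennreal (V x) * indicator {x. r0 \<le> dist x x0} x \<partial>\<pi>)"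
    using l s_pos
    by (intro nn_integral_mono)
      (auto simp: L_def v_def V_def indicator_def intro!: ennreal_leI divide_right_mono \<Phi>_mono)
  also have "\<dots> \<le> ennreal (bound / (1 - q))"
  proof (rule stationary_lyapunov_bound[where P = P and M = borel])
    show "P \<in> borel \<rightarrow>\<^sub>M prob_algebra borel" using kernel by (simp add: markov_kernel_def)
    show "\<pi> \<in> space (prob_algebra borel)" "\<pi> \<bind> P = \<pi>"
      using \<pi> by (simp_all add: equilibrium_measure_def)
    show "{x. r0 \<le> dist x x0} \<in> sets borel" by measurable
  qed (use q in \<open>auto simp: q_def V_nonneg bound_nonneg intro: V_decay V_bounded\<close>)
  finally have "v * measure \<pi> L \<le> C0 \<epsilon> \<rho> s K"
    using q by (simp add: C0_eq q_def bound_def)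
  then have "measure \<pi> L \<le> C0 \<epsilon> \<rho> s K * exp (- (\<Phi> l / (2 * s\<^sup>2)))"
    by (simp add: v_def exp_minus field_simps)
  then show ?thesis by (simp add: L_def Phi_eq)
qed

end

theorem theorem3:
  fixes P :: "'a::polish_space \<Rightarrow> 'a measure" and \<epsilon> \<rho> s :: real and x0 :: 'a
    and K :: "real \<Rightarrow> real"
  assumes "\<epsilon> > 0"
    and "eps_geodesic \<epsilon> TYPE('a)"
    and "markov_kernel P"
    and "\<rho> > 0"
    and "\<And>x. \<epsilon> < dist x x0 \<Longrightarrow> dist x x0 \<le> 2 * \<epsilon> \<Longrightarrow>
           enn2ereal (W1 (return borel x0) (P x)) \<le> ereal (dist x0 x - \<rho>)"
    and "antimono_on {0..} K"
    and "\<And>r. r \<ge> 0 \<Longrightarrow> K r \<ge> 0"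
    and "\<And>x. local_coarse_ricci P \<epsilon> x \<ge> ereal (K (dist x x0))"
    and "s > 0"
    and "\<And>x. gaussian_exp_moments s (P x)"
  shows "\<forall>l \<pi>. l > 2 * \<epsilon> + ln 2 * s\<^sup>2 / \<rho> \<longrightarrow> equilibrium_measure P \<pi> \<longrightarrow>
           measure \<pi> {x. dist x x0 \<ge> l} \<le> C0 \<epsilon> \<rho> s K * exp (- (1 / (2 * s\<^sup>2)) * Phi \<epsilon> \<rho> K l)"
proof (intro allI impI)
  fix l \<pi>
  assume l: "l > 2 * \<epsilon> + ln 2 * s\<^sup>2 / \<rho>" and \<pi>: "equilibrium_measure P \<pi>"
  interpret nonneg_curved_chain P \<epsilon> \<rho> s x0 K
    by (rule nonneg_curved_chain.intro) (fact assms)+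
  show "measure \<pi> {x. dist x x0 \<ge> l} \<le> C0 \<epsilon> \<rho> s K * exp (- (1 / (2 * s\<^sup>2)) * Phi \<epsilon> \<rho> K l)"
  proof (cases "\<exists>y. \<epsilon> < dist y x0")
    case True
    then interpret far_reaching_chain P \<epsilon> \<rho> s x0 K by unfold_locales
    show ?thesis using concentration[OF _ \<pi>] l by (simp add: r0_def)
  next
    case False
    \<comment> \<open>The whole space lies within \<epsilon> of \<open>x0\<close> and
      \<open>\<epsilon> < l\<close>, so the tail event is empty and \<open>C0 \<ge> 0\<close>
      settles the claim.\<close>
    have "ln 2 * s\<^sup>2 / \<rho> \<ge> 0" using \<rho>_pos by simp
    then have "\<epsilon> < l" using l \<epsilon>_pos by linarith
    then have "{x. dist x x0 \<ge> l} = {}" using False order.strict_trans2[OF \<open>\<epsilon> < l\<close>] by blast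
    moreover have "C0 \<epsilon> \<rho> s K \<ge> 0" by (simp add: C0_def)
    ultimately show ?thesis by simp
  qed
qed

end
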